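(* Let $A$ be a non-negative reducible square matrix of order $N$ of the form $$A=\begin{pmatrix}A_1&B\\ \mathbf{0}&A_2\end{pmatrix},$$ where $A_1$ and $A_2$ are non-negative irreducible square matrices of order $n_1$ and $n_2$, respectively, and $B$ is a non-negative matrix, different from zero, of size $n_1\times n_2$, with $n_1+n_2=N$. Let $P_A$ and $P_{A_2}$ be the row-normalizations of $A$ and $A_2$, respectively. Fix $\lambda\in(0,1)$ and let $X(\lambda)=(1-\lambda)(I_N-\lambda P_A)^{-1}$. Then for any personalization vector $\mathbf{v}\in\mathbb{R}^{N\times1}$ with $\|\mathbf{v}\|_1=1$, the recursive sequence $\{\mathbf{x}_k\}_{k\ge0}\subset\mathbb{R}^{N\times1}$ with $\mathbf{x}_0=\mathbf{v}$ defined by $$\mathbf{x}_k^T=\mathbf{x}_{k-1}^TX(\lambda)=\mathbf{v}^TX(\lambda)^k,\qquad k\ge1,$$ converges to the vector $\mathbf{x}^T=(\ \mathbf{0}_{n_1\times1}^T\ |\ \mathbf{c}_2^T\ )$, where $\mathbf{c}_2\in\mathbb{R}^{n_2\times1}$ is the left-hand Perron vector of $P_{A_2}$.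
   Context: Vectors are column matrices. A vector or matrix is non-negative (positive) if all its entries are $\ge 0$ ($>0$). $\mathbf{e}=(1,\dots,1)^T$ and $\|\mathbf{x}\|_1=\sum_i|x_i|$. A personalization vector is a positive probability vector: $\mathbf{v}>0$ and $\mathbf{v}^T\mathbf{e}=1$. A square matrix $A$ of order $N\ge 2$ is reducible if there is a permutation matrix $R$ such that $R^TAR=\begin{pmatrix}X&Y\\ \mathbf{0}&Z\end{pmatrix}$ with $X,Z$ square (of order at least 1); otherwise it is irreducible. A $1\times1$ matrix is called irreducible when its entry is nonzero. Row-normalization: for a non-negative matrix $A=(a_{ij})$ with no zero row, $P_A=(p_{ij})$ is given by $p_{ij}=a_{ij}/\sum_k a_{ik}$; it is row-stochastic. Left-hand Perron vector: for a non-negative irreducible matrix $M$, the unique vector $\mathbf{q}$ with $\mathbf{q}^TM=\rho(M)\mathbf{q}^T$, $\mathbf{q}>0$, $\mathbf{q}^T\mathbf{e}=1$, where $\rho(M)$ is the spectral radius. *)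

theory Defs
  imports
    "Jordan_Normal_Form.Spectral_Radius"
    "Jordan_Normal_Form.Gauss_Jordan_Elimination"
    "HOL-Combinatorics.Permutations"
begin

definition nonneg_mat :: "real mat \<Rightarrow> bool" where
  "nonneg_mat A \<longleftrightarrow> (\<forall>i<dim_row A. \<forall>j<dim_col A. 0 \<le> A $$ (i, j))"

definition pos_vec :: "real vec \<Rightarrow> bool" where
  "pos_vec v \<longleftrightarrow> (\<forall>i<dim_vec v. 0 < v $ i)"

definition vec_norm1 :: "real vec \<Rightarrow> real" where
  "vec_norm1 v = (\<Sum>i<dim_vec v. \<bar>v $ i\<bar>)"

definition ones_vec :: "nat \<Rightarrow> real vec" where
  "ones_vec n = vec n (\<lambda>_. 1)"

definition personalization_vec :: "real vec \<Rightarrow> bool" where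
  "personalization_vec v \<longleftrightarrow> pos_vec v \<and> v \<bullet> ones_vec (dim_vec v) = 1"

text \<open>Vectors of the matrix library are not matrices, so the row vector \<open>v\<^sup>T M\<close> is
  represented by its transpose \<open>M\<^sup>T v\<close>.\<close>

definition vec_mult_mat :: "real vec \<Rightarrow> real mat \<Rightarrow> real vec" (infixl \<open>\<^sub>v*\<close> 70) where
  "v \<^sub>v* M = transpose_mat M *\<^sub>v v"

definition permutation_mat :: "nat \<Rightarrow> real mat \<Rightarrow> bool" where
  "permutation_mat n R \<longleftrightarrow>
     (\<exists>p. p permutes {..<n} \<and> R = mat n n (\<lambda>(i, j). if i = p j then 1 else 0))"

definition reducible_mat :: "real mat \<Rightarrow> bool" where
  "reducible_mat A \<longleftrightarrow>
     square_mat A \<and> 2 \<le> dim_row A \<and>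
     (\<exists>R. permutation_mat (dim_row A) R \<and>
       (\<exists>r s X Y Z. 1 \<le> r \<and> 1 \<le> s \<and>
          X \<in> carrier_mat r r \<and> Y \<in> carrier_mat r s \<and> Z \<in> carrier_mat s s \<and>
          transpose_mat R * A * R = four_block_mat X Y (0\<^sub>m s r) Z))"

definition irreducible_mat :: "real mat \<Rightarrow> bool" where
  "irreducible_mat A \<longleftrightarrow>
     (A \<in> carrier_mat 1 1 \<and> A $$ (0, 0) \<noteq> 0) \<or>
     (square_mat A \<and> 2 \<le> dim_row A \<and> \<not> reducible_mat A)"

text \<open>A zero row is sent to a zero row, since \<open>x / 0 = 0\<close>; the notion is meant for matrices
  without zero rows.\<close>

definition row_normalize :: "real mat \<Rightarrow> real mat" where
  "row_normalize A =
     mat (dim_row A) (dim_col A) (\<lambda>(i, j). A $$ (i, j) / (\<Sum>k<dim_col A. A $$ (i, k)))"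

text \<open>By the Perron--Frobenius theorem the description below is satisfied by exactly one vector
  whenever \<open>M\<close> is non-negative and irreducible.\<close>

definition left_perron_vector :: "real mat \<Rightarrow> real vec" where
  "left_perron_vector M =
     (THE q. q \<in> carrier_vec (dim_row M) \<and>
        q \<^sub>v* M = spectral_radius (map_mat complex_of_real M) \<cdot>\<^sub>v q \<and>
        pos_vec q \<and> q \<bullet> ones_vec (dim_row M) = 1)"

text \<open>\<open>mat_inverse\<close> returns \<open>Some\<close> exactly for the invertible square matrices, and
  \<open>I - \<lambda> P\<close> is invertible for row-stochastic \<open>P\<close> and \<open>0 < \<lambda> < 1\<close>.\<close>

definition resolvent_mat :: "real \<Rightarrow> real mat \<Rightarrow> real mat" where
  "resolvent_mat l P =
     (1 - l) \<cdot>\<^sub>m the (mat_inverse (1\<^sub>m (dim_row P) - l \<cdot>\<^sub>m P))"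

text \<open>The type of vectors of arbitrary dimension carries no topology; convergence in
  \<open>\<real>\<^sup>n\<close> is entrywise convergence.\<close>

definition vec_converges_to :: "(nat \<Rightarrow> real vec) \<Rightarrow> real vec \<Rightarrow> bool" where
  "vec_converges_to x l \<longleftrightarrow>
     (\<forall>k. dim_vec (x k) = dim_vec l) \<and>
     (\<forall>i<dim_vec l. (\<lambda>k. x k $ i) \<longlonglongrightarrow> l $ i)"

end

theory Submission
  imports Defs
begin

text \<open>Write \<open>P\<close> for the row-normalization of \<open>A\<close>. The resolvent \<open>X\<close> satisfies
  \<open>X = \<lambda> P X + (1 - \<lambda>) I\<close>, so by the minimum principle it is stochastic, and the zero set of any
  column \<open>j\<close> of \<open>X\<close> is a set of states, not containing \<open>j\<close>, that \<open>P\<close> cannot leave. For \<open>j\<close> in the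
  second block no nonempty such set exists: irreducibility of \<open>A\<^sub>2\<close> and \<open>A\<^sub>1\<close> reduces it to the
  whole first block, which \<open>B \<noteq> 0\<close> excludes. So \<open>X\<close> has a positive column and (Doeblin) contracts
  the 1-norm on vectors of total mass zero; hence the iteration converges to the vector of mass one
  fixed by \<open>P\<close>, and therefore by \<open>X\<close>, namely the stationary vector of the second block padded with
  zeros.\<close>

section \<open>Vocabulary and index formulas for row vectors\<close>

definition stochastic_mat :: "nat \<Rightarrow> real mat \<Rightarrow> bool" where
  "stochastic_mat n P \<longleftrightarrow>
     P \<in> carrier_mat n n \<and> (\<forall>i<n. \<forall>j<n. 0 \<le> P $$ (i, j)) \<and> (\<forall>i<n. (\<Sum>j<n. P $$ (i, j)) = 1)"

text \<open>Only the zero pattern of \<open>A\<close> enters, so row-normalization preserves the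
  notion when all row sums are positive. It takes the place of the permutation matrices in
  \<open>reducible_mat\<close>.\<close>

definition absorbing_set :: "real mat \<Rightarrow> nat set \<Rightarrow> bool" where
  "absorbing_set A Z \<longleftrightarrow>
     Z \<subseteq> {..<dim_row A} \<and> (\<forall>i\<in>Z. \<forall>j\<in>{..<dim_row A} - Z. A $$ (i, j) = 0)"

lemma sum_lessThan_add:
  fixes f :: "nat \<Rightarrow> 'a::comm_monoid_add"
  shows "(\<Sum>i<m + n. f i) = (\<Sum>i<m. f i) + (\<Sum>i<n. f (m + i))"
  by (induction n) (simp_all add: add.assoc)

lemma vec_mult_mat_index:
  assumes "A \<in> carrier_mat n m" "v \<in> carrier_vec n" "j < m"
  shows "(v \<^sub>v* A) $ j = (\<Sum>i<n. v $ i * A $$ (i, j))"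
  using assms
  by (auto simp: vec_mult_mat_def scalar_prod_def atLeast0LessThan mult.commute intro!: sum.cong)

lemma vec_mult_mat_carrier [simp]: "A \<in> carrier_mat n m \<Longrightarrow> v \<^sub>v* A \<in> carrier_vec m"
  by (rule carrier_vecI) (simp add: vec_mult_mat_def)

lemma vec_mult_mat_mult:
  assumes "v \<in> carrier_vec n" "A \<in> carrier_mat n m" "B \<in> carrier_mat m k"
  shows "v \<^sub>v* (A * B) = v \<^sub>v* A \<^sub>v* B"
  unfolding vec_mult_mat_def using assms
  by (simp add: transpose_mult[of A n m B k] assoc_mult_mat_vec[of _ k m _ n])

lemma scalar_prod_ones_vec: "v \<in> carrier_vec n \<Longrightarrow> v \<bullet> ones_vec n = (\<Sum>i<n. v $ i)"
  by (auto simp: ones_vec_def scalar_prod_def atLeast0LessThan)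

section \<open>Irreducible matrices\<close>

lemma irreducible_mat_dim_pos: "irreducible_mat A \<Longrightarrow> 0 < dim_row A"
  by (auto simp: irreducible_mat_def)

text \<open>Reordering the indices so that a nontrivial \<open>Z\<close> comes last brings
  \<open>A\<close> into block upper triangular form and makes it reducible. In order 1 the index set
  has no other subsets.\<close>

lemma absorbing_set_trivial:
  assumes "irreducible_mat A" and Z: "absorbing_set A Z"
  shows "Z = {} \<or> Z = {..<dim_row A}"
proof (cases "2 \<le> dim_row A")
  case False
  with irreducible_mat_dim_pos[OF assms(1)] have "{..<dim_row A} = {0}" by auto
  with Z show ?thesis unfolding absorbing_set_def by auto
next
  case True
  define n where "n = dim_row A"
  have sq: "square_mat A" and nred: "\<not> reducible_mat A"
    using assms(1) True unfolding irreducible_mat_def by auto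
  have A: "A \<in> carrier_mat n n" using sq by (auto simp: n_def)
  have Zn: "Z \<subseteq> {..<n}" and Z0: "\<And>i j. i \<in> Z \<Longrightarrow> j < n \<Longrightarrow> j \<notin> Z \<Longrightarrow> A $$ (i, j) = 0"
    using Z unfolding absorbing_set_def n_def by auto
  have fin: "finite Z" using Zn finite_subset by blast
  show ?thesis
  proof (rule ccontr)
    assume "\<not> ?thesis"
    then have ne: "Z \<noteq> {}" "Z \<noteq> {..<n}" by (auto simp: n_def)
    \<comment> \<open>The complement of \<open>Z\<close>, of size \<open>r\<close>, is listed first
      and \<open>Z\<close> last, which places the zero block at the lower left.\<close>
    define s where "s = card Z"
    define r where "r = n - s"
    have s1: "1 \<le> s" using ne fin by (simp add: s_def Suc_le_eq card_gt_0_iff)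
    have "s < n"
      using ne Zn unfolding s_def by (metis card_lessThan finite_lessThan psubsetI psubset_card_mono)
    then have r1: "1 \<le> r" and rs: "r + s = n" unfolding r_def by auto
    have "card {..<r} = card ({..<n} - Z)"
      using Zn fin by (simp add: card_Diff_subset r_def s_def)
    then obtain f where f: "bij_betw f {..<r} ({..<n} - Z)"
      by (metis bij_betw_iff_card finite_Diff finite_lessThan)
    have "card {r..<n} = card Z" using rs by (simp add: s_def)
    then obtain g where g: "bij_betw g {r..<n} Z"
      using fin by (metis bij_betw_iff_card finite_atLeastLessThan)
    \<comment> \<open>Outside \<open>{..<n}\<close> the map is the identity, as
      \<open>permutes\<close> demands.\<close>
    define p where "p i = (if i < r then f i else if i < n then g i else i)" for i
    have pf: "bij_betw p {..<r} ({..<n} - Z)"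
      using f by (rule bij_betw_cong[THEN iffD1, rotated]) (auto simp: p_def)
    have pg: "bij_betw p {r..<n} Z"
      using g by (rule bij_betw_cong[THEN iffD1, rotated]) (auto simp: p_def)
    have "bij_betw p ({..<r} \<union> {r..<n}) (({..<n} - Z) \<union> Z)"
      by (rule bij_betw_combine[OF pf pg]) auto
    moreover have "{..<r} \<union> {r..<n} = {..<n}" using rs by auto
    moreover have "({..<n} - Z) \<union> Z = {..<n}" using Zn by auto
    ultimately have bp: "bij_betw p {..<n} {..<n}" by simp
    have perm: "p permutes {..<n}"
      by (rule bij_imp_permutes[OF bp]) (use rs in \<open>auto simp: p_def\<close>)
    have pn: "i < n \<Longrightarrow> p i < n" for i using permutes_in_image[OF perm, of i] by simp
    \<comment> \<open>Column \<open>j\<close> of \<open>R\<close> is the unit vector at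
      \<open>p j\<close>, so conjugation by \<open>R\<close> relabels both indices by
      \<open>p\<close>.\<close>
    define R where "R = mat n n (\<lambda>(i, j). if i = p j then 1 else 0 :: real)"
    have R: "R \<in> carrier_mat n n" by (simp add: R_def)
    have AR: "(A * R) $$ (i, j) = A $$ (i, p j)" if "i < n" "j < n" for i j
      using that A pn[OF that(2)]
      by (simp add: R_def scalar_prod_def if_distrib[of "(*) _"] cong: if_cong)
    define C where "C = transpose_mat R * A * R"
    have C: "C \<in> carrier_mat n n" using A R by (simp add: C_def)
    have Cij: "C $$ (i, j) = A $$ (p i, p j)" if "i < n" "j < n" for i j
    proof -
      have "C = transpose_mat R * (A * R)" using A R by (simp add: C_def assoc_mult_mat[of _ n n _ n _ n])
      then have "C $$ (i, j) = (\<Sum>k = 0..<n. R $$ (k, i) * (A * R) $$ (k, j))"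
        using A R that by (simp add: scalar_prod_def)
      also have "\<dots> = (\<Sum>k = 0..<n. if k = p i then A $$ (k, p j) else 0)"
        by (rule sum.cong) (use that AR in \<open>auto simp: R_def\<close>)
      finally show ?thesis using pn[OF that(1)] by simp
    qed
    define K where "K = mat r r (\<lambda>(i, j). C $$ (i, j))"
    define L where "L = mat r s (\<lambda>(i, j). C $$ (i, r + j))"
    define M where "M = mat s s (\<lambda>(i, j). C $$ (r + i, r + j))"
    have "C = four_block_mat K L (0\<^sub>m s r) M"
    proof (rule eq_matI)
      fix i j assume "i < dim_row (four_block_mat K L (0\<^sub>m s r) M)"
        "j < dim_col (four_block_mat K L (0\<^sub>m s r) M)"
      then have ij: "i < n" "j < n" using rs by (auto simp: K_def M_def)
      have "C $$ (i, j) = 0" if "r \<le> i" "j < r"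
      proof -
        have "p i \<in> Z" using pg that ij by (auto simp: bij_betw_def)
        moreover have "p j \<in> {..<n} - Z" using pf that by (auto simp: bij_betw_def)
        ultimately show ?thesis using Cij ij Z0 by auto
      qed
      then show "C $$ (i, j) = four_block_mat K L (0\<^sub>m s r) M $$ (i, j)"
        using ij rs by (auto simp: K_def L_def M_def)
    qed (use C rs in \<open>auto simp: K_def M_def\<close>)
    then have dec: "transpose_mat R * A * R = four_block_mat K L (0\<^sub>m s r) M" by (simp add: C_def)
    have "permutation_mat n R" unfolding permutation_mat_def R_def using perm by blast
    moreover have KLM: "K \<in> carrier_mat r r" "L \<in> carrier_mat r s" "M \<in> carrier_mat s s"
      by (auto simp: K_def L_def M_def)
    have "\<exists>r s X Y Z. 1 \<le> r \<and> 1 \<le> s \<and>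
        X \<in> carrier_mat r r \<and> Y \<in> carrier_mat r s \<and> Z \<in> carrier_mat s s \<and>
        transpose_mat R * A * R = four_block_mat X Y (0\<^sub>m s r) Z"
      by (rule exI[of _ r], rule exI[of _ s], rule exI[of _ K], rule exI[of _ L], rule exI[of _ M])
        (intro conjI r1 s1 KLM dec)
    ultimately have "reducible_mat A"
      unfolding reducible_mat_def n_def[symmetric] using sq True[folded n_def] by blast
    with nred show False by simp
  qed
qed

text \<open>A zero row \<open>i\<close> would make \<open>{i}\<close> absorbing, hence the whole
  index set; but the entry of an irreducible matrix of order 1 is nonzero.\<close>

lemma irreducible_row_sum_pos:
  assumes "irreducible_mat A" "A \<in> carrier_mat n n" "nonneg_mat A" "i < n"
  shows "0 < (\<Sum>j<n. A $$ (i, j))"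
proof (rule ccontr)
  have nn: "\<And>j. j < n \<Longrightarrow> 0 \<le> A $$ (i, j)" using assms by (auto simp: nonneg_mat_def)
  assume "\<not> ?thesis"
  with nn have "(\<Sum>j<n. A $$ (i, j)) = 0" by (meson sum_nonneg lessThan_iff not_less order_antisym)
  then have z: "\<And>j. j < n \<Longrightarrow> A $$ (i, j) = 0" using nn by (subst (asm) sum_nonneg_eq_0_iff) auto
  then have "absorbing_set A {i}" using assms by (auto simp: absorbing_set_def)
  from absorbing_set_trivial[OF assms(1) this] assms(2,4) have "{..<n} = {i}" by auto
  then have "card {..<n} = card {i}" by simp
  then have "n = 1" by simp
  with assms z show False by (auto simp: irreducible_mat_def)
qed

section \<open>Stochastic matrices\<close>

lemma stochastic_matD:
  assumes "stochastic_mat n P"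
  shows "P \<in> carrier_mat n n" "\<And>i j. i < n \<Longrightarrow> j < n \<Longrightarrow> 0 \<le> P $$ (i, j)"
    "\<And>i. i < n \<Longrightarrow> (\<Sum>j<n. P $$ (i, j)) = 1"
  using assms by (auto simp: stochastic_mat_def)

lemma stochastic_row_normalize:
  assumes "A \<in> carrier_mat n n" "nonneg_mat A" "\<And>i. i < n \<Longrightarrow> 0 < (\<Sum>j<n. A $$ (i, j))"
  shows "stochastic_mat n (row_normalize A)"
  unfolding stochastic_mat_def
proof (intro conjI allI impI)
  have A: "dim_row A = n" "dim_col A = n" using assms(1) by auto
  show "row_normalize A \<in> carrier_mat n n" using A by (simp add: row_normalize_def)
  fix i assume i: "i < n"
  have *: "row_normalize A $$ (i, j) = A $$ (i, j) / (\<Sum>k<n. A $$ (i, k))" if "j < n" for j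
    using i that A by (simp add: row_normalize_def)
  show "0 \<le> row_normalize A $$ (i, j)" if "j < n" for j
    using assms(2,3) i that A by (simp add: * nonneg_mat_def less_imp_le)
  show "(\<Sum>j<n. row_normalize A $$ (i, j)) = 1"
    using assms(3)[OF i] by (simp add: * flip: sum_divide_distrib)
qed

lemma row_normalize_eq_0_iff:
  assumes "A \<in> carrier_mat n n" "\<And>i. i < n \<Longrightarrow> 0 < (\<Sum>j<n. A $$ (i, j))" "i < n" "j < n"
  shows "row_normalize A $$ (i, j) = 0 \<longleftrightarrow> A $$ (i, j) = 0"
  using assms(1,3,4) assms(2)[of i] by (auto simp: row_normalize_def)

lemma absorbing_set_row_normalize:
  assumes "A \<in> carrier_mat n n" "\<And>i. i < n \<Longrightarrow> 0 < (\<Sum>j<n. A $$ (i, j))"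
  shows "absorbing_set (row_normalize A) Z \<longleftrightarrow> absorbing_set A Z"
proof -
  have "dim_row (row_normalize A) = n" "dim_row A = n" using assms(1) by (auto simp: row_normalize_def)
  then show ?thesis
    unfolding absorbing_set_def using row_normalize_eq_0_iff[OF assms] by (auto simp: subset_iff)
qed

section \<open>The resolvent of a stochastic matrix and the convergence of its iterates\<close>

text \<open>At an index where \<open>w\<close> takes its minimum \<open>m\<close>, the weighted
  average of \<open>w\<close> is at least \<open>m\<close>. The hypothesis there gives
  \<open>l * m \<le> m\<close>, which with \<open>l < 1\<close> excludes a negative
  \<open>m\<close>.\<close>

lemma stochastic_minimum_principle:
  fixes w :: "nat \<Rightarrow> real"
  assumes P: "stochastic_mat n P" and l: "0 < l" "l < 1"
    and w: "\<And>i. i < n \<Longrightarrow> l * (\<Sum>j<n. P $$ (i, j) * w j) \<le> w i"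
    and i: "i < n"
  shows "0 \<le> w i"
proof -
  define m where "m = Min (w ` {..<n})"
  have ne: "w ` {..<n} \<noteq> {}" using i by auto
  then have "m \<in> w ` {..<n}" unfolding m_def by (intro Min_in) auto
  then obtain k where k: "k < n" "m = w k" by auto
  have m: "m \<le> w j" if "j < n" for j using that unfolding m_def by (intro Min_le) auto
  have "m = (\<Sum>j<n. P $$ (k, j) * m)"
    using stochastic_matD(3)[OF P k(1)] by (simp flip: sum_distrib_right)
  also have "\<dots> \<le> (\<Sum>j<n. P $$ (k, j) * w j)"
    using stochastic_matD(2)[OF P k(1)] m by (intro sum_mono mult_left_mono) auto
  finally have "l * m \<le> m" using w[OF k(1)] l k(2) by (smt (verit) mult_left_mono)
  then have "(1 - l) * m \<ge> 0" by (simp add: algebra_simps)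
  then have "0 \<le> m" using l by (simp add: zero_le_mult_iff)
  with m[OF i] show ?thesis by simp
qed

text \<open>The minimum principle applies to both \<open>w\<close> and \<open>- w\<close>. In matrix
  terms, \<open>I - l P\<close> is injective.\<close>

lemma stochastic_fixed_eq_0:
  fixes w :: "nat \<Rightarrow> real"
  assumes P: "stochastic_mat n P" and l: "0 < l" "l < 1"
    and w: "\<And>i. i < n \<Longrightarrow> w i = l * (\<Sum>j<n. P $$ (i, j) * w j)"
    and i: "i < n"
  shows "w i = 0"
proof -
  have "0 \<le> w i" by (rule stochastic_minimum_principle[OF P l _ i]) (metis w order_refl)
  moreover have "0 \<le> - w i"
  proof (rule stochastic_minimum_principle[OF P l _ i])
    show "l * (\<Sum>j<n. P $$ (k, j) * - w j) \<le> - w k" if "k < n" for k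
      using w[OF that] by (simp add: sum_negf)
  qed
  ultimately show ?thesis by simp
qed

text \<open>Injectivity of \<open>I - l P\<close> guarantees that \<open>mat_inverse\<close> returns
  \<open>Some Y\<close>; the equation is \<open>(I - l P) Y = I\<close> scaled by
  \<open>1 - l\<close> and read entrywise. Later arguments use the resolvent only through
  it.\<close>

lemma resolvent_mat_equation:
  assumes P: "stochastic_mat n P" and l: "0 < l" "l < 1"
  shows "resolvent_mat l P \<in> carrier_mat n n"
    and "\<And>i j. i < n \<Longrightarrow> j < n \<Longrightarrow> resolvent_mat l P $$ (i, j)
      = l * (\<Sum>k<n. P $$ (i, k) * resolvent_mat l P $$ (k, j)) + (if i = j then 1 - l else 0)"
proof -
  note Pc = stochastic_matD(1)[OF P]
  define D where "D = 1\<^sub>m n - l \<cdot>\<^sub>m P"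
  have D: "D \<in> carrier_mat n n" using Pc by (auto simp: D_def)
  \<comment> \<open>An arbitrary \<open>f\<close> is allowed because the identity serves both a
    kernel vector of \<open>D\<close> and the columns of \<open>Y\<close>.\<close>
  have Dsum: "(\<Sum>k<n. D $$ (i, k) * f k) = f i - l * (\<Sum>k<n. P $$ (i, k) * f k)"
    if "i < n" for i and f :: "nat \<Rightarrow> real"
  proof -
    have "(\<Sum>k<n. D $$ (i, k) * f k) = (\<Sum>k<n. (if k = i then f k else 0) - l * (P $$ (i, k) * f k))"
      by (rule sum.cong) (use Pc that in \<open>auto simp: D_def algebra_simps\<close>)
    then show ?thesis using that by (simp add: sum_subtractf sum_distrib_left)
  qed
  have "det D \<noteq> 0"
  proof
    assume "det D = 0"
    then obtain w where w: "w \<in> carrier_vec n" "w \<noteq> 0\<^sub>v n" "D *\<^sub>v w = 0\<^sub>v n"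
      using det_0_iff_vec_prod_zero_field[OF D] by auto
    have "w $ i = l * (\<Sum>j<n. P $$ (i, j) * w $ j)" if "i < n" for i
    proof -
      have "(D *\<^sub>v w) $ i = (\<Sum>k<n. D $$ (i, k) * w $ k)"
        using D w(1) that by (auto simp: scalar_prod_def atLeast0LessThan)
      with w(3) Dsum[OF that] that show ?thesis by simp
    qed
    then have "w $ i = 0" if "i < n" for i
      using stochastic_fixed_eq_0[OF P l, of "\<lambda>i. w $ i"] that by blast
    then have "w = 0\<^sub>v n" using w(1) by (intro eq_vecI) auto
    with w(2) show False ..
  qed
  \<comment> \<open>\<open>b\<close> is the extension slot of the ring record of matrices; both
    facts must be taken at the same value for the membership in \<open>Units\<close> to
    match.\<close>
  then obtain Y where Y: "mat_inverse D = Some Y"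
    using mat_inverse(1)[OF D, where b = "()"] det_non_zero_imp_unit[OF D, where b = "()"]
    by (cases "mat_inverse D") auto
  from mat_inverse(2)[OF D Y] have DY: "D * Y = 1\<^sub>m n" and Yc: "Y \<in> carrier_mat n n" by auto
  have X: "resolvent_mat l P = (1 - l) \<cdot>\<^sub>m Y"
    using Y Pc by (simp add: resolvent_mat_def D_def)
  show "resolvent_mat l P \<in> carrier_mat n n" using Yc by (simp add: X)
  fix i j assume ij: "i < n" "j < n"
  have "(\<Sum>k<n. D $$ (i, k) * Y $$ (k, j)) = (D * Y) $$ (i, j)"
    using D Yc ij by (auto simp: scalar_prod_def atLeast0LessThan)
  then have "Y $$ (i, j) = l * (\<Sum>k<n. P $$ (i, k) * Y $$ (k, j)) + (if i = j then 1 else 0)"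
    using Dsum[OF ij(1), of "\<lambda>k. Y $$ (k, j)"] ij by (simp add: DY)
  then have "(1 - l) * Y $$ (i, j)
    = (1 - l) * (l * (\<Sum>k<n. P $$ (i, k) * Y $$ (k, j))) + (if i = j then 1 - l else 0)"
    by (simp add: distrib_left)
  moreover have "(\<Sum>k<n. P $$ (i, k) * resolvent_mat l P $$ (k, j))
    = (1 - l) * (\<Sum>k<n. P $$ (i, k) * Y $$ (k, j))"
    unfolding sum_distrib_left by (rule sum.cong) (use Yc ij in \<open>auto simp: X\<close>)
  moreover have "resolvent_mat l P $$ (i, j) = (1 - l) * Y $$ (i, j)"
    using Yc ij by (simp add: X)
  ultimately show "resolvent_mat l P $$ (i, j)
      = l * (\<Sum>k<n. P $$ (i, k) * resolvent_mat l P $$ (k, j)) + (if i = j then 1 - l else 0)"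
    by (metis mult.left_commute)
qed

text \<open>Each column meets the hypothesis of the minimum principle, because the diagonal term
  \<open>1 - l\<close> is positive. The row sums are handled by uniqueness.\<close>

lemma stochastic_resolvent_mat:
  assumes P: "stochastic_mat n P" and l: "0 < l" "l < 1"
  shows "stochastic_mat n (resolvent_mat l P)"
proof -
  define X where "X = resolvent_mat l P"
  note X = resolvent_mat_equation[OF P l, folded X_def]
  have nn: "0 \<le> X $$ (i, j)" if "i < n" "j < n" for i j
  proof (rule stochastic_minimum_principle[OF P l _ that(1)])
    show "l * (\<Sum>k<n. P $$ (i, k) * X $$ (k, j)) \<le> X $$ (i, j)" if "i < n" for i
      using X(2)[OF that \<open>j < n\<close>] l by simp
  qed
  \<comment> \<open>Summing the resolvent equation over \<open>j\<close> gives an inhomogeneous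
    equation for the row sums that the constant 1 also solves, so the defect solves the homogeneous
    one.\<close>
  have "(\<Sum>j<n. X $$ (i, j)) - 1 = 0" if i: "i < n" for i
  proof (rule stochastic_fixed_eq_0[OF P l _ i])
    fix i assume i: "i < n"
    have "(\<Sum>j<n. X $$ (i, j)) = l * (\<Sum>j<n. \<Sum>k<n. P $$ (i, k) * X $$ (k, j)) + (1 - l)"
    proof -
      have "(\<Sum>j<n. X $$ (i, j))
        = (\<Sum>j<n. l * (\<Sum>k<n. P $$ (i, k) * X $$ (k, j)) + (if i = j then 1 - l else 0))"
        using X(2)[OF i] by (intro sum.cong refl) (metis lessThan_iff)
      then show ?thesis using i by (simp add: sum.distrib sum_distrib_left)
    qed
    also have "(\<Sum>j<n. \<Sum>k<n. P $$ (i, k) * X $$ (k, j))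
      = (\<Sum>k<n. P $$ (i, k) * (\<Sum>j<n. X $$ (k, j)))"
      by (subst sum.swap) (simp add: sum_distrib_left)
    finally show "(\<Sum>j<n. X $$ (i, j)) - 1 = l * (\<Sum>k<n. P $$ (i, k) * ((\<Sum>j<n. X $$ (k, j)) - 1))"
      using stochastic_matD(3)[OF P i] by (simp add: algebra_simps sum_subtractf)
  qed
  with nn X(1) show ?thesis unfolding X_def[symmetric] stochastic_mat_def by simp
qed

text \<open>Pairing \<open>q\<close> with column \<open>j\<close> of the resolvent equation and
  using stationarity under \<open>P\<close> gives \<open>S = l * S + (1 - l) * q j\<close> for the
  sum \<open>S\<close> in question.\<close>

lemma resolvent_mat_stationary:
  assumes P: "stochastic_mat n P" and l: "0 < l" "l < 1"
    and q: "\<And>j. j < n \<Longrightarrow> (\<Sum>i<n. q i * P $$ (i, j)) = q j" and j: "j < n"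
  shows "(\<Sum>i<n. q i * resolvent_mat l P $$ (i, j)) = q j"
proof -
  define X where "X = resolvent_mat l P"
  note X = resolvent_mat_equation[OF P l, folded X_def]
  define S where "S = (\<Sum>i<n. q i * X $$ (i, j))"
  have "S = (\<Sum>i<n. l * (\<Sum>k<n. q i * P $$ (i, k) * X $$ (k, j)) + (if i = j then (1 - l) * q i else 0))"
    unfolding S_def
  proof (rule sum.cong)
    fix i assume "i \<in> {..<n}"
    then have "q i * X $$ (i, j)
      = q i * (l * (\<Sum>k<n. P $$ (i, k) * X $$ (k, j)) + (if i = j then 1 - l else 0))"
      using X(2)[of i j] j by simp
    then show "q i * X $$ (i, j)
      = l * (\<Sum>k<n. q i * P $$ (i, k) * X $$ (k, j)) + (if i = j then (1 - l) * q i else 0)"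
      by (simp add: distrib_left sum_distrib_left mult_ac)
  qed simp
  also have "\<dots> = l * (\<Sum>i<n. \<Sum>k<n. q i * P $$ (i, k) * X $$ (k, j)) + (1 - l) * q j"
    using j by (simp add: sum.distrib sum_distrib_left)
  also have "(\<Sum>i<n. \<Sum>k<n. q i * P $$ (i, k) * X $$ (k, j))
    = (\<Sum>k<n. (\<Sum>i<n. q i * P $$ (i, k)) * X $$ (k, j))"
    by (subst sum.swap) (simp add: sum_distrib_right)
  also have "\<dots> = S" unfolding S_def by (rule sum.cong) (use q in auto)
  finally have "(1 - l) * S = (1 - l) * q j" by (simp add: algebra_simps)
  then show ?thesis using l by (simp add: S_def X_def)
qed

text \<open>The zero set of column \<open>j\<close> of the resolvent is absorbing and misses \<open>j\<close>.\<close>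

lemma resolvent_mat_column_pos:
  assumes P: "stochastic_mat n P" and l: "0 < l" "l < 1" and j: "j < n"
    and absorb: "\<And>Z. absorbing_set P Z \<Longrightarrow> j \<notin> Z \<Longrightarrow> Z = {}"
    and i: "i < n"
  shows "0 < resolvent_mat l P $$ (i, j)"
proof -
  define X where "X = resolvent_mat l P"
  note X = resolvent_mat_equation[OF P l, folded X_def]
  note nn = stochastic_matD(2)[OF stochastic_resolvent_mat[OF P l], folded X_def]
  define Z where "Z = {i. i < n \<and> X $$ (i, j) = 0}"
  \<comment> \<open>At a zero of the column, the resolvent equation writes 0 as a sum of nonnegative
    terms. All of them vanish, including the diagonal term, which would be \<open>1 - l > 0\<close>
    if \<open>i = j\<close>.\<close>
  have step: "P $$ (i, k) * X $$ (k, j) = 0" "i \<noteq> j" if "i \<in> Z" "k < n" for i k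
  proof -
    have pos: "0 \<le> P $$ (i, k) * X $$ (k, j)" if "k < n" for k
      using \<open>i \<in> Z\<close> that stochastic_matD(2)[OF P, of i k] nn[of k j] j by (auto simp: Z_def)
    then have "0 \<le> (\<Sum>k<n. P $$ (i, k) * X $$ (k, j))" by (intro sum_nonneg) auto
    moreover have "0 = l * (\<Sum>k<n. P $$ (i, k) * X $$ (k, j)) + (if i = j then 1 - l else 0)"
      using \<open>i \<in> Z\<close> X(2)[of i j] j by (auto simp: Z_def)
    ultimately have *: "(\<Sum>k<n. P $$ (i, k) * X $$ (k, j)) = 0" and "i \<noteq> j"
      using l by (auto split: if_splits) (smt (verit) mult_nonneg_nonneg)+
    from * show "P $$ (i, k) * X $$ (k, j) = 0"
      using pos that(2) by (subst (asm) sum_nonneg_eq_0_iff) auto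
    show "i \<noteq> j" by fact
  qed
  have "absorbing_set P Z"
    using step(1) stochastic_matD(1)[OF P] by (auto simp: absorbing_set_def Z_def)
  moreover have "j \<notin> Z" using step(2) j by blast
  ultimately have "Z = {}" by (rule absorb)
  with i nn[OF i j] show ?thesis by (force simp: Z_def X_def)
qed

text \<open>Subtracting \<open>\<delta>\<close> from column \<open>j0\<close> leaves a nonnegative matrix with row sums \<open>1 - \<delta>\<close>
  and does not change the image of a vector of total mass zero.\<close>

lemma doeblin_contraction:
  fixes y :: "nat \<Rightarrow> real"
  assumes X: "stochastic_mat n X" and j0: "j0 < n" and \<delta>: "\<And>i. i < n \<Longrightarrow> \<delta> \<le> X $$ (i, j0)"
    and y: "(\<Sum>i<n. y i) = 0"
  shows "(\<Sum>j<n. \<bar>\<Sum>i<n. y i * X $$ (i, j)\<bar>) \<le> (1 - \<delta>) * (\<Sum>i<n. \<bar>y i\<bar>)"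
proof -
  define W where "W i j = X $$ (i, j) - (if j = j0 then \<delta> else 0)" for i j
  have W: "0 \<le> W i j" if "i < n" "j < n" for i j
    using that stochastic_matD(2)[OF X] \<delta> by (auto simp: W_def)
  have Wsum: "(\<Sum>j<n. W i j) = 1 - \<delta>" if "i < n" for i
    using that stochastic_matD(3)[OF X] j0 by (simp add: W_def sum_subtractf)
  have eq: "(\<Sum>i<n. y i * X $$ (i, j)) = (\<Sum>i<n. y i * W i j)" for j
    using y by (simp add: W_def right_diff_distrib sum_subtractf flip: sum_distrib_right)
  have "(\<Sum>j<n. \<bar>\<Sum>i<n. y i * X $$ (i, j)\<bar>) \<le> (\<Sum>j<n. \<Sum>i<n. \<bar>y i\<bar> * W i j)"
    unfolding eq
  proof (rule sum_mono)
    fix j assume "j \<in> {..<n}"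
    then have "(\<Sum>i<n. \<bar>y i * W i j\<bar>) = (\<Sum>i<n. \<bar>y i\<bar> * W i j)"
      by (intro sum.cong) (use W in \<open>auto simp: abs_mult\<close>)
    then show "\<bar>\<Sum>i<n. y i * W i j\<bar> \<le> (\<Sum>i<n. \<bar>y i\<bar> * W i j)"
      by (metis sum_abs)
  qed
  also have "\<dots> = (\<Sum>i<n. \<bar>y i\<bar> * (\<Sum>j<n. W i j))"
    by (subst sum.swap) (simp add: sum_distrib_left)
  also have "\<dots> = (\<Sum>i<n. \<bar>y i\<bar> * (1 - \<delta>))"
    by (rule sum.cong) (simp_all add: Wsum)
  also have "\<dots> = (1 - \<delta>) * (\<Sum>i<n. \<bar>y i\<bar>)"
    by (simp add: mult.commute flip: sum_distrib_right)
  finally show ?thesis .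
qed

text \<open>The difference from \<open>q\<close> keeps total mass zero, so its 1-norm shrinks
  geometrically, with ratio \<open>1 - \<delta>\<close> for the smallest entry
  \<open>\<delta>\<close> of the positive column.\<close>

lemma doeblin_converges:
  fixes x :: "nat \<Rightarrow> nat \<Rightarrow> real"
  assumes X: "stochastic_mat n X" and j0: "j0 < n" and pos: "\<And>i. i < n \<Longrightarrow> 0 < X $$ (i, j0)"
    and q: "\<And>j. j < n \<Longrightarrow> (\<Sum>i<n. q i * X $$ (i, j)) = q j"
    and x: "\<And>k j. j < n \<Longrightarrow> x (Suc k) j = (\<Sum>i<n. x k i * X $$ (i, j))"
    and mass: "(\<Sum>i<n. x 0 i) = (\<Sum>i<n. q i)" and j: "j < n"
  shows "(\<lambda>k. x k j) \<longlonglongrightarrow> q j"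
proof -
  define \<delta> where "\<delta> = Min ((\<lambda>i. X $$ (i, j0)) ` {..<n})"
  have "\<delta> \<in> (\<lambda>i. X $$ (i, j0)) ` {..<n}"
    unfolding \<delta>_def by (rule Min_in) (use j in auto)
  then obtain i0 where i0: "i0 < n" "\<delta> = X $$ (i0, j0)" by auto
  then have \<delta>0: "0 < \<delta>" using pos by simp
  have \<delta>: "\<delta> \<le> X $$ (i, j0)" if "i < n" for i
    unfolding \<delta>_def by (rule Min_le) (use that in auto)
  \<comment> \<open>An entry of a stochastic row is at most 1. This keeps
    \<open>1 - \<delta>\<close> nonnegative, as both the induction for \<open>bound\<close> and the
    geometric limit require.\<close>
  have \<delta>1: "\<delta> \<le> 1"
    using i0 stochastic_matD(2,3)[OF X i0(1)] j0
      member_le_sum[of j0 "{..<n}" "\<lambda>j. X $$ (i0, j)"] by auto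
  define y where "y k i = x k i - q i" for k i
  have y: "y (Suc k) j = (\<Sum>i<n. y k i * X $$ (i, j))" if "j < n" for k j
    using x[OF that] q[OF that] by (simp add: y_def left_diff_distrib sum_subtractf)
  have y0: "(\<Sum>i<n. y k i) = 0" for k
  proof (induction k)
    case 0
    then show ?case using mass by (simp add: y_def sum_subtractf)
  next
    case (Suc k)
    have "(\<Sum>j<n. y (Suc k) j) = (\<Sum>i<n. y k i * (\<Sum>j<n. X $$ (i, j)))"
      by (simp add: y sum_distrib_left) (rule sum.swap)
    also have "\<dots> = (\<Sum>i<n. y k i)" by (rule sum.cong) (simp_all add: stochastic_matD(3)[OF X])
    finally show ?case using Suc by simp
  qed
  have bound: "(\<Sum>i<n. \<bar>y k i\<bar>) \<le> (1 - \<delta>) ^ k * (\<Sum>i<n. \<bar>y 0 i\<bar>)" for k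
  proof (induction k)
    case (Suc k)
    have "(\<Sum>j<n. \<bar>y (Suc k) j\<bar>) \<le> (1 - \<delta>) * (\<Sum>i<n. \<bar>y k i\<bar>)"
      using doeblin_contraction[OF X j0 \<delta> y0[of k]] by (simp add: y)
    also have "\<dots> \<le> (1 - \<delta>) * ((1 - \<delta>) ^ k * (\<Sum>i<n. \<bar>y 0 i\<bar>))"
      using Suc \<delta>1 by (intro mult_left_mono) auto
    finally show ?case by (simp add: mult.assoc)
  qed simp
  have lim: "(\<lambda>k. (1 - \<delta>) ^ k * (\<Sum>i<n. \<bar>y 0 i\<bar>)) \<longlonglongrightarrow> 0"
    using \<delta>0 \<delta>1 by (intro tendsto_mult_left_zero LIMSEQ_power_zero) auto
  have "\<bar>y k j\<bar> \<le> (1 - \<delta>) ^ k * (\<Sum>i<n. \<bar>y 0 i\<bar>)" for k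
    using bound[of k] member_le_sum[of j "{..<n}" "\<lambda>i. \<bar>y k i\<bar>"] j by auto
  then have "(\<lambda>k. \<bar>y k j\<bar>) \<longlonglongrightarrow> 0"
    by (intro tendsto_sandwich[OF _ _ tendsto_const lim]) auto
  then have "(\<lambda>k. y k j) \<longlonglongrightarrow> 0" by (rule tendsto_rabs_zero_cancel)
  then show ?thesis by (simp add: y_def LIM_zero_iff)
qed

section \<open>The left Perron vector of a stochastic matrix\<close>

text \<open>The all-ones vector has eigenvalue 1. Conversely, the eigenvalue equation at an entry of
  maximal modulus \<open>m > 0\<close> bounds \<open>norm \<mu> * m\<close> by an average of moduli,
  hence by \<open>m\<close>.\<close>

lemma spectral_radius_stochastic:
  assumes P: "stochastic_mat n P" and n: "0 < n"
  shows "spectral_radius (map_mat complex_of_real P) = 1"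
proof -
  define C where "C = map_mat complex_of_real P"
  note Pc = stochastic_matD(1)[OF P]
  have C: "C \<in> carrier_mat n n" using Pc by (simp add: C_def)
  have mv: "(C *\<^sub>v u) $ i = (\<Sum>j<n. of_real (P $$ (i, j)) * u $ j)"
    if "u \<in> carrier_vec n" "i < n" for u i
    using that Pc by (auto simp: C_def scalar_prod_def atLeast0LessThan)
  have "eigenvector C (vec n (\<lambda>_. 1)) 1"
    unfolding eigenvector_def
  proof (intro conjI)
    show "vec n (\<lambda>_. 1) \<in> carrier_vec (dim_row C)" using C by auto
    show "vec n (\<lambda>_. 1) \<noteq> (0\<^sub>v (dim_row C) :: complex vec)"
    proof
      assume "vec n (\<lambda>_. 1) = (0\<^sub>v (dim_row C) :: complex vec)"
      then have "vec n (\<lambda>_. 1) $ 0 = (0\<^sub>v (dim_row C) :: complex vec) $ 0" by simp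
      then show False using n C by simp
    qed
    show "C *\<^sub>v vec n (\<lambda>_. 1) = 1 \<cdot>\<^sub>v vec n (\<lambda>_. 1)"
    proof (rule eq_vecI)
      fix i assume "i < dim_vec (1 \<cdot>\<^sub>v vec n (\<lambda>_. 1 :: complex))"
      then have i: "i < n" by simp
      have "(\<Sum>j<n. complex_of_real (P $$ (i, j))) = 1"
        using stochastic_matD(3)[OF P i] by (metis of_real_1 of_real_sum)
      then show "(C *\<^sub>v vec n (\<lambda>_. 1)) $ i = (1 \<cdot>\<^sub>v vec n (\<lambda>_. 1)) $ i"
        using i by (simp add: mv)
    qed (use C in auto)
  qed
  then have "1 \<in> norm ` spectrum C"
    unfolding spectrum_def eigenvalue_def by (force intro: image_eqI[of _ _ 1])
  then have ge: "1 \<le> spectral_radius C" by (rule spectral_radius_mem_max(2)[OF C n])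
  obtain \<mu> where \<mu>: "spectral_radius C = norm \<mu>" "eigenvalue C \<mu>"
    using spectral_radius_mem_max(1)[OF C n] by (auto simp: spectrum_def)
  then obtain u where u: "u \<in> carrier_vec n" "u \<noteq> 0\<^sub>v n" "C *\<^sub>v u = \<mu> \<cdot>\<^sub>v u"
    using C by (auto simp: eigenvalue_def eigenvector_def)
  define m where "m = Max ((\<lambda>i. norm (u $ i)) ` {..<n})"
  have "m \<in> (\<lambda>i. norm (u $ i)) ` {..<n}" unfolding m_def by (rule Max_in) (use n in auto)
  then obtain i where i: "i < n" "m = norm (u $ i)" by auto
  have m: "norm (u $ j) \<le> m" if "j < n" for j
    unfolding m_def by (rule Max_ge) (use that in auto)
  have "m \<noteq> 0"
  proof
    assume "m = 0"
    then have "u $ j = 0" if "j < n" for j using m[OF that] by simp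
    then have "u = 0\<^sub>v n" using u(1) by (intro eq_vecI) auto
    with u(2) show False ..
  qed
  then have m0: "0 < m" using i(2) by simp
  have "norm \<mu> * m = norm ((C *\<^sub>v u) $ i)" using u i by (simp add: norm_mult)
  also have "\<dots> = norm (\<Sum>j<n. of_real (P $$ (i, j)) * u $ j)" using mv[OF u(1) i(1)] by simp
  also have "\<dots> \<le> (\<Sum>j<n. P $$ (i, j) * m)"
    by (rule sum_norm_le)
      (use m stochastic_matD(2)[OF P i(1)] in \<open>auto simp: norm_mult intro!: mult_left_mono\<close>)
  also have "\<dots> = m" using stochastic_matD(3)[OF P i(1)] by (simp flip: sum_distrib_right)
  finally have "norm \<mu> \<le> 1" using m0 by simp
  with ge \<mu>(1) show ?thesis by (simp add: C_def)
qed

text \<open>As \<open>1\<close> is an eigenvalue of the transpose there is a signed stationary vector; its entrywise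
  absolute value is subinvariant and hence, having the same mass as its image, invariant.\<close>

lemma stationary_vector_exists:
  assumes P: "stochastic_mat n P" and n: "0 < n"
  obtains q where "\<And>i. i < n \<Longrightarrow> 0 \<le> q i" "(\<Sum>i<n. q i) = 1"
    "\<And>j. j < n \<Longrightarrow> (\<Sum>i<n. q i * P $$ (i, j)) = q j"
proof -
  note Pc = stochastic_matD(1)[OF P]
  define D where "D = 1\<^sub>m n - P"
  have D: "D \<in> carrier_mat n n" using Pc by (auto simp: D_def)
  have Dij: "D $$ (i, j) = (if i = j then 1 else 0) - P $$ (i, j)" if "i < n" "j < n" for i j
    using that Pc by (simp add: D_def)
  \<comment> \<open>The all-ones vector is a right kernel vector of \<open>D\<close>; the
    determinant carries singularity over to the transpose, whose kernel yields the left vector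
    \<open>u\<close>.\<close>
  have "D *\<^sub>v vec n (\<lambda>_. 1) = 0\<^sub>v n"
    by (rule eq_vecI)
      (use D stochastic_matD(3)[OF P] in
        \<open>auto simp: scalar_prod_def atLeast0LessThan Dij sum_subtractf\<close>)
  moreover have "vec n (\<lambda>_. 1) \<noteq> (0\<^sub>v n :: real vec)"
    using n by (metis index_vec index_zero_vec(1) zero_neq_one)
  ultimately have "det D = 0"
    using det_0_iff_vec_prod_zero_field[OF D] by (metis vec_carrier)
  then have "det (transpose_mat D) = 0" using det_transpose[OF D] by simp
  then obtain u where u: "u \<in> carrier_vec n" "u \<noteq> 0\<^sub>v n" "transpose_mat D *\<^sub>v u = 0\<^sub>v n"
    using det_0_iff_vec_prod_zero_field[of "transpose_mat D" n] D by auto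
  have uP: "(\<Sum>i<n. u $ i * P $$ (i, j)) = u $ j" if "j < n" for j
  proof -
    have "0 = (u \<^sub>v* D) $ j" using u(3) that by (simp add: vec_mult_mat_def)
    also have "\<dots> = (\<Sum>i<n. u $ i * D $$ (i, j))" by (rule vec_mult_mat_index[OF D u(1) that])
    also have "\<dots> = (\<Sum>i<n. (if i = j then u $ i else 0) - u $ i * P $$ (i, j))"
      by (rule sum.cong) (use that in \<open>auto simp: Dij algebra_simps\<close>)
    also have "\<dots> = u $ j - (\<Sum>i<n. u $ i * P $$ (i, j))"
      using that by (simp add: sum_subtractf)
    finally show ?thesis by simp
  qed
  define a where "a i = \<bar>u $ i\<bar>" for i
  have le: "a j \<le> (\<Sum>i<n. a i * P $$ (i, j))" if "j < n" for j
  proof -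
    have "a j = \<bar>\<Sum>i<n. u $ i * P $$ (i, j)\<bar>" using uP[OF that] by (simp add: a_def)
    also have "\<dots> \<le> (\<Sum>i<n. \<bar>u $ i * P $$ (i, j)\<bar>)" by (rule sum_abs)
    also have "\<dots> = (\<Sum>i<n. a i * P $$ (i, j))"
      by (rule sum.cong) (use that stochastic_matD(2)[OF P] in \<open>auto simp: a_def abs_mult\<close>)
    finally show ?thesis .
  qed
  have "(\<Sum>j<n. \<Sum>i<n. a i * P $$ (i, j)) = (\<Sum>i<n. a i * (\<Sum>j<n. P $$ (i, j)))"
    by (subst sum.swap) (simp add: sum_distrib_left)
  also have "\<dots> = (\<Sum>i<n. a i)"
    by (rule sum.cong) (simp_all add: stochastic_matD(3)[OF P])
  \<comment> \<open>Each summand is nonnegative by \<open>le\<close>, so a zero sum makes all of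
    them vanish.\<close>
  finally have "(\<Sum>j<n. (\<Sum>i<n. a i * P $$ (i, j)) - a j) = 0" by (simp add: sum_subtractf)
  then have aP: "(\<Sum>i<n. a i * P $$ (i, j)) = a j" if "j < n" for j
    using that le by (subst (asm) sum_nonneg_eq_0_iff) auto
  define S where "S = (\<Sum>i<n. a i)"
  have "S \<noteq> 0"
  proof
    assume "S = 0"
    then have "a i = 0" if "i < n" for i
      using that unfolding S_def by (subst (asm) sum_nonneg_eq_0_iff) (auto simp: a_def)
    then have "u = 0\<^sub>v n" using u(1) by (intro eq_vecI) (auto simp: a_def)
    with u(2) show False ..
  qed
  moreover have "0 \<le> S" unfolding S_def by (rule sum_nonneg) (simp add: a_def)
  ultimately have S: "0 < S" by simp
  show ?thesis
  proof
    show "0 \<le> a i / S" if "i < n" for i using S by (simp add: a_def)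
    show "(\<Sum>i<n. a i / S) = 1" using S by (simp add: S_def flip: sum_divide_distrib)
    show "(\<Sum>i<n. a i / S * P $$ (i, j)) = a j / S" if "j < n" for j
      using aP[OF that] by (simp flip: sum_divide_distrib)
  qed
qed

text \<open>The support of \<open>q\<close> is absorbing: where \<open>q j = 0\<close>, the
  nonnegative inflows \<open>q i * P $$ (i, j)\<close> sum to zero, so no state of the support leads
  to \<open>j\<close>. Mass one makes the support nonempty.\<close>

lemma stationary_vector_pos:
  assumes P: "stochastic_mat n P"
    and absorb: "\<And>Z. absorbing_set P Z \<Longrightarrow> Z = {} \<or> Z = {..<n}"
    and nn: "\<And>i. i < n \<Longrightarrow> 0 \<le> q i" and mass: "(\<Sum>i<n. q i) = 1"
    and q: "\<And>j. j < n \<Longrightarrow> (\<Sum>i<n. q i * P $$ (i, j)) = q j" and i: "i < n"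
  shows "0 < q i"
proof -
  define Z where "Z = {i. i < n \<and> q i \<noteq> 0}"
  have "P $$ (i, j) = 0" if "i \<in> Z" "j < n" "j \<notin> Z" for i j
  proof -
    have "(\<Sum>i<n. q i * P $$ (i, j)) = 0" using q that by (simp add: Z_def)
    then have "q i * P $$ (i, j) = 0"
      using that nn stochastic_matD(2)[OF P] by (subst (asm) sum_nonneg_eq_0_iff) (auto simp: Z_def)
    with that show ?thesis by (simp add: Z_def)
  qed
  then have "absorbing_set P Z"
    using stochastic_matD(1)[OF P] by (auto simp: absorbing_set_def Z_def)
  moreover have "Z \<noteq> {}"
  proof
    assume "Z = {}"
    then have "(\<Sum>i<n. q i) = 0" by (intro sum.neutral) (auto simp: Z_def)
    with mass show False by simp
  qed
  ultimately have "Z = {..<n}" using absorb by blast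
  then have "i \<in> Z" using i by simp
  with nn[OF i] show ?thesis by (simp add: Z_def)
qed

text \<open>Uniqueness: two stationary vectors of mass one are limits of the same resolvent iteration.\<close>

lemma left_perron_vector_stochastic:
  assumes P: "stochastic_mat n P" and n: "0 < n"
    and absorb: "\<And>Z. absorbing_set P Z \<Longrightarrow> Z = {} \<or> Z = {..<n}"
  defines "q \<equiv> left_perron_vector P"
  shows "q \<in> carrier_vec n" "(\<Sum>i<n. q $ i) = 1"
    "\<And>j. j < n \<Longrightarrow> (\<Sum>i<n. q $ i * P $$ (i, j)) = q $ j"
proof -
  note Pc = stochastic_matD(1)[OF P]
  \<comment> \<open>This repeats the body of \<open>left_perron_vector\<close>, so that the definite
    description folds to \<open>THE c. perron c\<close>.\<close>
  define perron where "perron c \<longleftrightarrow> c \<in> carrier_vec (dim_row P) \<and>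
    c \<^sub>v* P = spectral_radius (map_mat complex_of_real P) \<cdot>\<^sub>v c \<and>
    pos_vec c \<and> c \<bullet> ones_vec (dim_row P) = 1" for c
  have perron_iff: "perron c \<longleftrightarrow> c \<in> carrier_vec n \<and>
    (\<forall>j<n. (\<Sum>i<n. c $ i * P $$ (i, j)) = c $ j) \<and> (\<forall>i<n. 0 < c $ i) \<and> (\<Sum>i<n. c $ i) = 1" for c
  proof (cases "c \<in> carrier_vec n")
    case True
    have "c \<^sub>v* P = c \<longleftrightarrow> (\<forall>j<n. (\<Sum>i<n. c $ i * P $$ (i, j)) = c $ j)"
    proof
      assume eq: "c \<^sub>v* P = c"
      show "\<forall>j<n. (\<Sum>i<n. c $ i * P $$ (i, j)) = c $ j"
        using vec_mult_mat_index[OF Pc True] unfolding eq by metis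
    next
      assume "\<forall>j<n. (\<Sum>i<n. c $ i * P $$ (i, j)) = c $ j"
      then show "c \<^sub>v* P = c"
        using True vec_mult_mat_carrier[OF Pc, of c]
        by (intro eq_vecI) (simp_all add: vec_mult_mat_index[OF Pc True])
    qed
    then show ?thesis
      using True Pc by (auto simp: perron_def spectral_radius_stochastic[OF P n] pos_vec_def
          scalar_prod_ones_vec)
  next
    case False
    then show ?thesis using Pc by (simp add: perron_def)
  qed
  obtain f where f: "\<And>i. i < n \<Longrightarrow> 0 \<le> f i" "(\<Sum>i<n. f i) = 1"
    "\<And>j. j < n \<Longrightarrow> (\<Sum>i<n. f i * P $$ (i, j)) = f j"
    using stationary_vector_exists[OF P n] by blast
  have "perron (vec n f)"
    unfolding perron_iff using f stationary_vector_pos[OF P absorb f] by auto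
  moreover have "c = d" if c: "perron c" and d: "perron d" for c d
  proof -
    \<comment> \<open>Any parameter in \<open>(0,1)\<close> would do in place of \<open>1/2\<close>.
      Column 0 is positive because an absorbing set missing 0 is not everything and hence is
      empty.\<close>
    define X where "X = resolvent_mat (1/2) P"
    have half: "0 < (1/2 :: real)" "(1/2 :: real) < 1" by auto
    have X: "stochastic_mat n X" unfolding X_def by (rule stochastic_resolvent_mat[OF P half])
    have Xpos: "0 < X $$ (i, 0)" if "i < n" for i
      unfolding X_def by (rule resolvent_mat_column_pos[OF P half n _ that]) (use absorb n in auto)
    have cX: "(\<Sum>i<n. c $ i * X $$ (i, j)) = c $ j" if "j < n" for j
      unfolding X_def by (rule resolvent_mat_stationary[OF P half _ that]) (use c perron_iff in auto)
    have dX: "(\<Sum>i<n. d $ i * X $$ (i, j)) = d $ j" if "j < n" for j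
      unfolding X_def by (rule resolvent_mat_stationary[OF P half _ that]) (use d perron_iff in auto)
    have "c $ j = d $ j" if "j < n" for j
    proof -
      \<comment> \<open>Being fixed by \<open>X\<close>, the vector \<open>c\<close> is a constant
        orbit of the iteration, and that orbit must converge to \<open>d\<close>.\<close>
      have "(\<lambda>k::nat. c $ j) \<longlonglongrightarrow> d $ j"
        by (rule doeblin_converges[where x = "\<lambda>_ i. c $ i" and q = "\<lambda>i. d $ i", OF X n Xpos dX])
          (use cX c d that perron_iff in auto)
      then show ?thesis by (simp add: LIMSEQ_const_iff)
    qed
    then show ?thesis using c d perron_iff by (intro eq_vecI) auto
  qed
  ultimately have "\<exists>!c. perron c" by blast
  then have "perron q"
    unfolding q_def left_perron_vector_def perron_def[symmetric] by (rule theI')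
  then show "q \<in> carrier_vec n" "(\<Sum>i<n. q $ i) = 1"
    "\<And>j. j < n \<Longrightarrow> (\<Sum>i<n. q $ i * P $$ (i, j)) = q $ j"
    unfolding perron_iff by auto
qed

section \<open>The block triangular matrix\<close>

text \<open>The trace of \<open>Z\<close> on the second block is absorbing for \<open>A2\<close> and
  misses \<open>j0 - m\<close>, so it is empty. Then \<open>Z\<close> is absorbing for
  \<open>A1\<close>, and if it were the whole first block, \<open>B\<close> would vanish.\<close>

lemma four_block_absorbing_set:
  assumes A1: "A1 \<in> carrier_mat m m" "irreducible_mat A1"
    and A2: "A2 \<in> carrier_mat n n" "irreducible_mat A2"
    and B: "B \<in> carrier_mat m n" "B \<noteq> 0\<^sub>m m n"
    and Z: "absorbing_set (four_block_mat A1 B (0\<^sub>m n m) A2) Z"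
    and j0: "m \<le> j0" "j0 < m + n" "j0 \<notin> Z"
  shows "Z = {}"
proof -
  let ?A = "four_block_mat A1 B (0\<^sub>m n m) A2"
  have Zs: "Z \<subseteq> {..<m + n}"
    and Z0: "\<And>i j. i \<in> Z \<Longrightarrow> j < m + n \<Longrightarrow> j \<notin> Z \<Longrightarrow> ?A $$ (i, j) = 0"
    using Z A1 A2 by (auto simp: absorbing_set_def)
  define Z2 where "Z2 = {i. m + i \<in> Z}"
  have "absorbing_set A2 Z2"
    unfolding absorbing_set_def
  proof (intro conjI ballI)
    show "Z2 \<subseteq> {..<dim_row A2}" using Zs A2 by (auto simp: Z2_def)
    fix i j assume "i \<in> Z2" "j \<in> {..<dim_row A2} - Z2"
    then show "A2 $$ (i, j) = 0"
      using Z0[of "m + i" "m + j"] Zs A1 A2 by (auto simp: Z2_def)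
  qed
  moreover have "j0 - m \<notin> Z2" "j0 - m < n" using j0 by (auto simp: Z2_def)
  ultimately have "Z2 = {}" using absorbing_set_trivial[OF A2(2)] A2(1) by auto
  then have Zm: "Z \<subseteq> {..<m}"
    using Zs by (auto simp: Z2_def) (metis le_add_diff_inverse not_le)
  have "absorbing_set A1 Z"
    unfolding absorbing_set_def
  proof (intro conjI ballI)
    show "Z \<subseteq> {..<dim_row A1}" using Zm A1 by auto
    fix i j assume "i \<in> Z" "j \<in> {..<dim_row A1} - Z"
    then show "A1 $$ (i, j) = 0" using Z0[of i j] Zm A1 A2 by auto
  qed
  then have "Z = {} \<or> Z = {..<m}" using absorbing_set_trivial[OF A1(2)] A1(1) by auto
  moreover have "Z \<noteq> {..<m}"
  proof
    assume Zm: "Z = {..<m}"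
    have "B = 0\<^sub>m m n"
    proof (rule eq_matI)
      fix i j assume "i < dim_row (0\<^sub>m m n :: real mat)" "j < dim_col (0\<^sub>m m n :: real mat)"
      then show "B $$ (i, j) = 0\<^sub>m m n $$ (i, j)"
        using Z0[of i "m + j"] Zm A1 A2 by auto
    qed (use B in auto)
    with B(2) show False ..
  qed
  ultimately show ?thesis by blast
qed

lemma four_block_row_sum:
  assumes "A1 \<in> carrier_mat m m" "A2 \<in> carrier_mat n n" "B \<in> carrier_mat m n"
  shows "i < m \<Longrightarrow> (\<Sum>j<m + n. four_block_mat A1 B (0\<^sub>m n m) A2 $$ (i, j))
      = (\<Sum>j<m. A1 $$ (i, j)) + (\<Sum>j<n. B $$ (i, j))"
    and "i < n \<Longrightarrow> (\<Sum>j<m + n. four_block_mat A1 B (0\<^sub>m n m) A2 $$ (m + i, j))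
      = (\<Sum>j<n. A2 $$ (i, j))"
  using assms by (auto simp: sum_lessThan_add)

theorem theorem5:
  fixes A A\<^sub>1 A\<^sub>2 B :: "real mat" and n\<^sub>1 n\<^sub>2 N :: nat
    and l :: real and X :: "real mat" and v :: "real vec" and x :: "nat \<Rightarrow> real vec"
  assumes "n\<^sub>1 + n\<^sub>2 = N"
    and "A \<in> carrier_mat N N" and "nonneg_mat A" and "reducible_mat A"
    and "A\<^sub>1 \<in> carrier_mat n\<^sub>1 n\<^sub>1" and "nonneg_mat A\<^sub>1" and "irreducible_mat A\<^sub>1"
    and "A\<^sub>2 \<in> carrier_mat n\<^sub>2 n\<^sub>2" and "nonneg_mat A\<^sub>2" and "irreducible_mat A\<^sub>2"
    and "B \<in> carrier_mat n\<^sub>1 n\<^sub>2" and "nonneg_mat B" and "B \<noteq> 0\<^sub>m n\<^sub>1 n\<^sub>2"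
    and "A = four_block_mat A\<^sub>1 B (0\<^sub>m n\<^sub>2 n\<^sub>1) A\<^sub>2"
    and "0 < l" and "l < 1"
    and "X = resolvent_mat l (row_normalize A)"
    and "v \<in> carrier_vec N" and "personalization_vec v" and "vec_norm1 v = 1"
    and "x 0 = v" and "\<And>k. 1 \<le> k \<Longrightarrow> x k = x (k - 1) \<^sub>v* X"
  shows "(\<forall>k\<ge>1. x k = v \<^sub>v* (X ^\<^sub>m k)) \<and>
         vec_converges_to x (0\<^sub>v n\<^sub>1 @\<^sub>v left_perron_vector (row_normalize A\<^sub>2))"
proof -
  note n = assms(1) and A = assms(2,3) and A1 = assms(5,6,7) and A2 = assms(8,9,10)
    and B = assms(11,12,13) and A_def = assms(14) and l = assms(15,16) and X_def = assms(17)
    and v = assms(18,19) and x0 = assms(21) and xs = assms(22)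
  define P where "P = row_normalize A"
  define P2 where "P2 = row_normalize A\<^sub>2"
  have n2: "0 < n\<^sub>2" using irreducible_mat_dim_pos[OF A2(3)] A2(1) by auto
  note sumA = four_block_row_sum[OF A1(1) A2(1) B(1), folded A_def, unfolded n]
  have sum2: "0 < (\<Sum>j<n\<^sub>2. A\<^sub>2 $$ (i, j))" if "i < n\<^sub>2" for i
    by (rule irreducible_row_sum_pos[OF A2(3,1,2) that])
  have sum_pos: "0 < (\<Sum>j<N. A $$ (i, j))" if i: "i < N" for i
  proof (cases "i < n\<^sub>1")
    case True
    have "0 \<le> (\<Sum>j<n\<^sub>2. B $$ (i, j))" using B(1,2) True by (intro sum_nonneg) (auto simp: nonneg_mat_def)
    then show ?thesis
      using sumA(1)[OF True] irreducible_row_sum_pos[OF A1(3,1,2) True] by simp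
  next
    case False
    then obtain k where "i = n\<^sub>1 + k" "k < n\<^sub>2" using i n
      by (auto simp: not_less dest!: le_Suc_ex)
    then show ?thesis using sumA(2) sum2 by simp
  qed
  have P: "stochastic_mat N P"
    unfolding P_def by (rule stochastic_row_normalize[OF A sum_pos])
  have P2: "stochastic_mat n\<^sub>2 P2"
    unfolding P2_def by (rule stochastic_row_normalize[OF A2(1,2) sum2])
  have P2_absorb: "Z = {} \<or> Z = {..<n\<^sub>2}" if "absorbing_set P2 Z" for Z
    using that absorbing_set_trivial[OF A2(3)] A2(1)
    by (auto simp: P2_def absorbing_set_row_normalize[OF A2(1) sum2])
  \<comment> \<open>With indices starting at 0, \<open>n\<^sub>1\<close> is the first index of the
    second block; its column of \<open>X\<close> is the positive one used for the
    contraction.\<close>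
  have P_absorb: "Z = {}" if "absorbing_set P Z" "n\<^sub>1 \<notin> Z" for Z
  proof (rule four_block_absorbing_set[OF A1(1,3) A2(1,3) B(1,3)])
    show "absorbing_set (four_block_mat A\<^sub>1 B (0\<^sub>m n\<^sub>2 n\<^sub>1) A\<^sub>2) Z"
      using that by (simp add: P_def absorbing_set_row_normalize[OF A(1) sum_pos] flip: A_def)
  qed (use that n2 in auto)
  have X: "stochastic_mat N X"
    unfolding X_def P_def[symmetric] by (rule stochastic_resolvent_mat[OF P l])
  have Xpos: "0 < X $$ (i, n\<^sub>1)" if "i < N" for i
    unfolding X_def P_def[symmetric]
    by (rule resolvent_mat_column_pos[OF P l _ P_absorb that]) (use n n2 in auto)
  note Xc = stochastic_matD(1)[OF X]
  have xSuc: "x (Suc k) = x k \<^sub>v* X" for k using xs[of "Suc k"] by simp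
  have x_carrier: "x k \<in> carrier_vec N" for k
    by (cases k) (use x0 v xSuc Xc in auto)
  have xpow: "x k = v \<^sub>v* (X ^\<^sub>m k)" for k
  proof (induction k)
    case 0
    have "transpose_mat (1\<^sub>m N) = (1\<^sub>m N :: real mat)" by simp
    then show ?case using x0 v(1) Xc by (simp add: vec_mult_mat_def)
  next
    \<comment> \<open>The power \<open>X ^\<^sub>m Suc k\<close> has its new factor on the right, as
      in the recursion for \<open>x\<close>.\<close>
    case (Suc k)
    then show ?case
      using vec_mult_mat_mult[OF v(1) pow_carrier_mat[OF Xc, of k] Xc] xSuc by simp
  qed
  define q where "q = left_perron_vector P2"
  note q = left_perron_vector_stochastic[OF P2 n2 P2_absorb, folded q_def]
  define c where "c = 0\<^sub>v n\<^sub>1 @\<^sub>v q"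
  have c: "c \<in> carrier_vec N" using q(1) n by (auto simp: c_def)
  have c1: "c $ i = 0" if "i < n\<^sub>1" for i using that q(1) by (simp add: c_def)
  have c2: "c $ (n\<^sub>1 + i) = q $ i" if "i < n\<^sub>2" for i using that q(1) by (simp add: c_def)
  \<comment> \<open>The function \<open>f\<close> stands for a column of \<open>P\<close> when
    stationarity is checked, and for the constant 1 when the mass is computed.\<close>
  have sum_c: "(\<Sum>i<N. c $ i * f i) = (\<Sum>i<n\<^sub>2. q $ i * f (n\<^sub>1 + i))" for f
    by (simp add: sum_lessThan_add c1 c2 flip: n)
  have Pblock1: "P $$ (n\<^sub>1 + i, j) = 0" if "i < n\<^sub>2" "j < n\<^sub>1" for i j
    using that A1(1) A2(1) by (simp add: P_def row_normalize_def A_def)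
  \<comment> \<open>The zero block leaves the lower rows of \<open>A\<close> with the row sums of
    \<open>A\<^sub>2\<close>, so normalization divides by the same numbers in both matrices.\<close>
  have Pblock2: "P $$ (n\<^sub>1 + i, n\<^sub>1 + j) = P2 $$ (i, j)" if "i < n\<^sub>2" "j < n\<^sub>2" for i j
  proof -
    have "A $$ (n\<^sub>1 + i, n\<^sub>1 + j) = A\<^sub>2 $$ (i, j)" using that A1(1) A2(1) by (simp add: A_def)
    then show ?thesis
      using that A(1) A2(1) n sumA(2)[OF that(1)] by (simp add: P_def P2_def row_normalize_def)
  qed
  have cP: "(\<Sum>i<N. c $ i * P $$ (i, j)) = c $ j" if j: "j < N" for j
  proof (cases "j < n\<^sub>1")
    case True
    then show ?thesis by (simp add: sum_c c1 Pblock1)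
  next
    case False
    then obtain k where "j = n\<^sub>1 + k" "k < n\<^sub>2" using j n
      by (auto simp: not_less dest!: le_Suc_ex)
    then show ?thesis using q(3) by (simp add: sum_c c2 Pblock2)
  qed
  have cX: "(\<Sum>i<N. c $ i * X $$ (i, j)) = c $ j" if "j < N" for j
    unfolding X_def P_def[symmetric] by (rule resolvent_mat_stationary[OF P l cP that])
  have "(\<Sum>i<N. v $ i) = 1"
    using v scalar_prod_ones_vec[OF v(1)] by (simp add: personalization_vec_def)
  moreover have "(\<Sum>i<N. c $ i) = 1" using sum_c[of "\<lambda>_. 1"] q(2) by simp
  ultimately have mass: "(\<Sum>i<N. x 0 $ i) = (\<Sum>i<N. c $ i)" by (simp add: x0)
  have "(\<lambda>k. x k $ j) \<longlonglongrightarrow> c $ j" if "j < N" for j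
    by (rule doeblin_converges[where x = "\<lambda>k i. x k $ i" and q = "\<lambda>i. c $ i",
          OF X _ Xpos cX _ mass that])
      (use n n2 vec_mult_mat_index[OF Xc x_carrier] in \<open>auto simp: xSuc\<close>)
  then have "vec_converges_to x c"
    unfolding vec_converges_to_def using c x_carrier by (metis carrier_vecD)
  with xpow show ?thesis by (simp add: c_def q_def P2_def)
qed

end
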